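(* Let $\mathcal{A} = (a_{i_1\cdots i_m})$ be a real $m$th order $n$-dimensional tensor. The following statements are equivalent: (i) $\mathcal{A}$ is semi-positive. (ii) For every $\mathbf{q} \in \mathbb{R}^n$ with $\mathbf{q} > \mathbf{0}$, the tensor complementarity problem TCP $(\mathbf{q}, \mathcal{A})$ has a unique solution. (iii) For every nonempty index set $N \subset I_n$ (with $N = I_n$ allowed), the system $$\mathcal{A}^{|N|}(\mathbf{x}^N)^{m-1} < \mathbf{0}, \quad \mathbf{x}^N \geq \mathbf{0}$$ has no solution $\mathbf{x}^N \in \mathbb{R}^{|N|}$.
   Context: $m,n$ are positive integers and $I_n = \{1,2,\dots,n\}$. A real $m$th order $n$-dimensional tensor is a multi-array $\mathcal{A} = (a_{i_1\cdots i_m})$ of real numbers with $i_j \in I_n$ for $j = 1,\dots,m$; no symmetry is assumed. For $\mathbf{x} \in \mathbb{R}^n$, $\mathcal{A}\mathbf{x}^{m-1} \in \mathbb{R}^n$ is the vector with components $(\mathcal{A}\mathbf{x}^{m-1})_i = \sum_{i_2,\dots,i_m=1}^n a_{i i_2\cdots i_m} x_{i_2}\cdots x_{i_m}$, $i \in I_n$. Vector inequalities are componentwise: $\mathbf{x} \geq \mathbf{0}$ means $x_i \geq 0$ for all $i$, $\mathbf{x} > \mathbf{0}$ means $x_i > 0$ for all $i$, and likewise $<\mathbf{0}$ means that every component is negative. $\mathcal{A}$ is semi-positive iff for each $\mathbf{x} \in \mathbb{R}^n$ with $\mathbf{x} \geq \mathbf{0}$ and $\mathbf{x} \neq \mathbf{0}$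 there exists $k \in I_n$ such that $x_k > 0$ and $(\mathcal{A}\mathbf{x}^{m-1})_k \geq 0$. For $\mathbf{q} \in \mathbb{R}^n$, TCP $(\mathbf{q},\mathcal{A})$ is the problem: find $\mathbf{x} \in \mathbb{R}^n$ such that $\mathbf{x} \geq \mathbf{0}$, $\mathbf{q} + \mathcal{A}\mathbf{x}^{m-1} \geq \mathbf{0}$, and $\mathbf{x}^\top(\mathbf{q} + \mathcal{A}\mathbf{x}^{m-1}) = 0$. For a nonempty $N \subset I_n$, the principal sub-tensor $\mathcal{A}^{|N|}$ is the tensor of order $m$ and dimension $|N|$ consisting of the entries $a_{i_1\cdots i_m}$ with all $i_1,\dots,i_m \in N$. Vectors $\mathbf{x}^N \in \mathbb{R}^{|N|}$ are indexed by $N$, and $\big(\mathcal{A}^{|N|}(\mathbf{x}^N)^{m-1}\big)_i = \sum_{i_2,\dots,i_m \in N} a_{i i_2\cdots i_m} x^N_{i_2}\cdots x^N_{i_m}$ for $i \in N$. For $N = I_n$ this is $\mathcal{A}$ itself. *)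

theory Defs
  imports Complex_Main "HOL-Library.FuncSet"
begin

text \<open>Vectors and tensors are indexed by a finite set \<open>I\<close>, so that the \<open>n\<close>-dimensional case
  (\<open>I = {1..n}\<close>) and the principal sub-tensors (\<open>I = N \<subseteq> {1..n}\<close>) share the same definitions.
  They are extensional functions (\<open>undefined\<close> outside the index range), so that HOL equality
  is equality of vectors and of tensors; this matters for unique solvability.\<close>

definition vectors :: "'i set \<Rightarrow> ('i \<Rightarrow> real) set" where
  "vectors I = I \<rightarrow>\<^sub>E UNIV"

definition zero_vector :: "'i set \<Rightarrow> 'i \<Rightarrow> real" where
  "zero_vector I = (\<lambda>i\<in>I. 0)"

text \<open>A multi-index \<open>(i\<^sub>1, \<dots>, i\<^sub>m)\<close> is a list of length \<open>m\<close>.\<close>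

definition multi_indices :: "nat \<Rightarrow> 'i set \<Rightarrow> 'i list set" where
  "multi_indices m I = {is. set is \<subseteq> I \<and> length is = m}"

definition tensors :: "nat \<Rightarrow> 'i set \<Rightarrow> ('i list \<Rightarrow> real) set" where
  "tensors m I = multi_indices m I \<rightarrow>\<^sub>E UNIV"

definition principal_subtensor ::
  "nat \<Rightarrow> 'i set \<Rightarrow> ('i list \<Rightarrow> real) \<Rightarrow> 'i list \<Rightarrow> real" where
  "principal_subtensor m N A = restrict A (multi_indices m N)"

text \<open>The vector \<open>A x\<^bsup>m-1\<^esup>\<close>. The list \<open>js\<close> stands for \<open>(i\<^sub>2, \<dots>, i\<^sub>m)\<close>; the definition
  is meant for \<open>m \<ge> 1\<close>.\<close>

definition tensor_apply ::
  "nat \<Rightarrow> 'i set \<Rightarrow> ('i list \<Rightarrow> real) \<Rightarrow> ('i \<Rightarrow> real) \<Rightarrow> 'i \<Rightarrow> real" where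
  "tensor_apply m I A x =
     (\<lambda>i\<in>I. \<Sum>js\<in>multi_indices (m - 1) I. A (i # js) * prod_list (map x js))"

definition semi_positive :: "nat \<Rightarrow> 'i set \<Rightarrow> ('i list \<Rightarrow> real) \<Rightarrow> bool" where
  "semi_positive m I A \<longleftrightarrow>
     (\<forall>x\<in>vectors I. (\<forall>i\<in>I. x i \<ge> 0) \<and> x \<noteq> zero_vector I \<longrightarrow>
        (\<exists>k\<in>I. x k > 0 \<and> tensor_apply m I A x k \<ge> 0))"

definition TCP_solution ::
  "nat \<Rightarrow> 'i set \<Rightarrow> ('i \<Rightarrow> real) \<Rightarrow> ('i list \<Rightarrow> real) \<Rightarrow> ('i \<Rightarrow> real) \<Rightarrow> bool" where
  "TCP_solution m I q A x \<longleftrightarrow>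
     x \<in> vectors I \<and>
     (\<forall>i\<in>I. x i \<ge> 0) \<and>
     (\<forall>i\<in>I. q i + tensor_apply m I A x i \<ge> 0) \<and>
     (\<Sum>i\<in>I. x i * (q i + tensor_apply m I A x i)) = 0"

end

theory Submission
  imports Defs
begin

text \<open>Both equivalences rest on the reading of the negation of semi-positivity: there is a nonzero
  \<open>x \<ge> 0\<close> such that \<open>A x\<^bsup>m-1\<^esup>\<close> is negative on the whole support of \<open>x\<close>.

  For the complementarity problem with \<open>q > 0\<close>, the zero vector is the natural solution.  Any
  solution \<open>x\<close> satisfies \<open>x\<^sub>k (q + A x\<^bsup>m-1\<^esup>)\<^sub>k = 0\<close> for each \<open>k\<close>, because these products are nonnegative
  and sum to zero; so \<open>A x\<^bsup>m-1\<^esup> = - q\<close> is negative on the support of \<open>x\<close>, and semi-positivity leaves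
  only \<open>x = 0\<close>.  Conversely, a vector \<open>x\<close> that violates semi-positivity solves the problem for a
  suitable \<open>q > 0\<close>: set \<open>q = - A x\<^bsup>m-1\<^esup>\<close> on the support and choose \<open>q\<close> large elsewhere.
  For \<open>m \<ge> 2\<close>, zero and \<open>x\<close> are then
  distinct solutions.

  For the sub-tensors, terms of \<open>A x\<^bsup>m-1\<^esup>\<close> that involve an index outside the support of \<open>x\<close> vanish, so
  on any \<open>N\<close> containing the support \<open>A x\<^bsup>m-1\<^esup>\<close> is computed by the principal sub-tensor
  (lemma \<open>tensor_apply_principal_subtensor\<close>).  A violating \<open>x\<close> restricted to its support therefore
  solves the strict system, and semi-positivity is inherited by the principal sub-tensors, for which
  a solution of the strict system would be a violation.

  The order \<open>m = 1\<close> is special: \<open>A x\<^bsup>m-1\<^esup>\<close> is then a constant vector, and need not vanish at zero.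
  Semi-positivity still makes it nonnegative there (lemma \<open>semi_positive_at_zero\<close>), and if it fails,
  \<open>2 x\<close> serves as a second solution besides \<open>x\<close>.\<close>

section \<open>Evaluation of tensors\<close>

lemma finite_multi_indices: "finite I \<Longrightarrow> finite (multi_indices m I)"
  unfolding multi_indices_def by (rule finite_lists_length_eq)

lemma tensor_apply_order_one:
  "i \<in> I \<Longrightarrow> tensor_apply 1 I A x i = A [i]"
proof -
  have "multi_indices 0 I = {[]}"
    by (auto simp: multi_indices_def)
  then show "i \<in> I \<Longrightarrow> ?thesis"
    by (simp add: tensor_apply_def)
qed

lemma tensor_apply_zero_vector:
  assumes "m \<ge> 2" "i \<in> I"
  shows "tensor_apply m I A (zero_vector I) i = 0"
proof -
  have "prod_list (map (zero_vector I) js) = 0" if js: "js \<in> multi_indices (m - 1) I" for js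
  proof (cases js)
    case Nil
    then show ?thesis using js assms by (simp add: multi_indices_def)
  next
    case (Cons j js')
    then show ?thesis using js by (simp add: multi_indices_def zero_vector_def)
  qed
  then show ?thesis
    using assms by (simp add: tensor_apply_def)
qed

lemma zero_vector_in_vectors: "zero_vector I \<in> vectors I"
  by (simp add: zero_vector_def vectors_def)

lemma vectors_nonzero_entry:
  assumes "x \<in> vectors I" "x \<noteq> zero_vector I" "\<forall>i\<in>I. x i \<ge> (0::real)"
  obtains i where "i \<in> I" "x i > 0"
proof -
  obtain i where "i \<in> I" "x i \<noteq> zero_vector I i"
    using assms(1,2) zero_vector_in_vectors[of I] unfolding vectors_def
    by (metis PiE_ext)
  then show thesis
    using that assms(3) by (force simp: zero_vector_def)
qed

text \<open>A product over a multi-index that leaves \<open>N\<close> contains an entry of \<open>x\<close> outside its support and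
  vanishes.\<close>

lemma tensor_apply_principal_subtensor:
  assumes "finite I" "N \<subseteq> I" "m \<ge> 1" "i \<in> N"
    and outside: "\<And>j. j \<in> I - N \<Longrightarrow> x j = 0"
    and agree: "\<And>j. j \<in> N \<Longrightarrow> y j = x j"
  shows "tensor_apply m N (principal_subtensor m N A) y i = tensor_apply m I A x i"
proof -
  have "(\<Sum>js\<in>multi_indices (m - 1) I. A (i # js) * prod_list (map x js))
      = (\<Sum>js\<in>multi_indices (m - 1) N. A (i # js) * prod_list (map x js))"
  proof (rule sum.mono_neutral_right)
    show "finite (multi_indices (m - 1) I)"
      using assms by (simp add: finite_multi_indices)
    show "multi_indices (m - 1) N \<subseteq> multi_indices (m - 1) I"
      using \<open>N \<subseteq> I\<close> by (auto simp: multi_indices_def)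
    show "\<forall>js\<in>multi_indices (m - 1) I - multi_indices (m - 1) N.
        A (i # js) * prod_list (map x js) = 0"
    proof
      fix js assume "js \<in> multi_indices (m - 1) I - multi_indices (m - 1) N"
      then obtain j where "j \<in> set js" "j \<in> I - N"
        by (auto simp: multi_indices_def)
      then have "0 \<in> set (map x js)"
        using outside by force
      then have "prod_list (map x js) = 0"
        by (simp only: prod_list_zero_iff)
      then show "A (i # js) * prod_list (map x js) = 0"
        by simp
    qed
  qed
  also have "\<dots> = (\<Sum>js\<in>multi_indices (m - 1) N.
      principal_subtensor m N A (i # js) * prod_list (map y js))"
  proof (rule sum.cong[OF refl])
    fix js assume js: "js \<in> multi_indices (m - 1) N"
    then have "i # js \<in> multi_indices m N"
      using assms by (auto simp: multi_indices_def)
    moreover have "map y js = map x js"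
      using js agree by (intro map_cong) (auto simp: multi_indices_def)
    ultimately show "A (i # js) * prod_list (map x js)
        = principal_subtensor m N A (i # js) * prod_list (map y js)"
      by (simp only: principal_subtensor_def restrict_apply if_True)
  qed
  finally show ?thesis
    using assms by (auto simp: tensor_apply_def)
qed

section \<open>Semi-positivity and the complementarity problem\<close>

text \<open>For \<open>m = 1\<close>, testing semi-positivity on the \<open>i\<close>-th unit vector singles out the \<open>i\<close>-th entry
  of the constant vector \<open>A x\<^bsup>0\<^esup>\<close>.\<close>

lemma semi_positive_at_zero:
  assumes "semi_positive m I A" "m \<ge> 1" "i \<in> I"
  shows "tensor_apply m I A (zero_vector I) i \<ge> 0"
proof (cases "m = 1")
  case True
  define e where "e = (\<lambda>j\<in>I. if j = i then 1 else 0 :: real)"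
  have "e \<in> vectors I" "\<forall>j\<in>I. e j \<ge> 0"
    by (auto simp: e_def vectors_def)
  moreover have "e i \<noteq> zero_vector I i"
    using \<open>i \<in> I\<close> by (simp add: e_def zero_vector_def)
  ultimately obtain k where "k \<in> I" "e k > 0" "tensor_apply m I A e k \<ge> 0"
    using assms(1) unfolding semi_positive_def by metis
  moreover from this have "k = i"
    by (auto simp: e_def split: if_splits)
  ultimately show ?thesis
    using True by (simp only: tensor_apply_order_one)
next
  case False
  then show ?thesis
    using assms tensor_apply_zero_vector[of m i I A] by simp
qed

lemma semi_positive_zero_solution:
  assumes "semi_positive m I A" "m \<ge> 1" "\<forall>i\<in>I. q i > 0"
  shows "TCP_solution m I q A (zero_vector I)"
  unfolding TCP_solution_def
proof (intro conjI ballI)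
  fix i assume "i \<in> I"
  then have "q i > 0" "tensor_apply m I A (zero_vector I) i \<ge> 0"
    using assms semi_positive_at_zero[of m I A i] by auto
  then show "q i + tensor_apply m I A (zero_vector I) i \<ge> 0"
    by simp
qed (simp_all add: zero_vector_in_vectors, simp_all add: zero_vector_def)

lemma semi_positive_solution_is_zero:
  assumes "finite I" "semi_positive m I A" "\<forall>i\<in>I. q i > 0" "TCP_solution m I q A x"
  shows "x = zero_vector I"
proof (rule ccontr)
  assume "x \<noteq> zero_vector I"
  then obtain k where k: "k \<in> I" "x k > 0" "tensor_apply m I A x k \<ge> 0"
    using assms(2,4) unfolding semi_positive_def TCP_solution_def by metis
  then have "x k * (q k + tensor_apply m I A x k) > 0"
    using assms(3) by (simp add: add_pos_nonneg)
  moreover have "x k * (q k + tensor_apply m I A x k) = 0"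
    using assms(1,4) k(1) sum_nonneg_eq_0_iff[of I "\<lambda>i. x i * (q i + tensor_apply m I A x i)"]
    unfolding TCP_solution_def by simp
  ultimately show False
    by simp
qed

text \<open>On the support of \<open>x\<close>, \<open>q\<close> must cancel the negative entries of \<open>A x\<^bsup>m-1\<^esup>\<close>; off the support it
  only has to be large.  Where the second solution comes from depends on the order: it is zero if
  \<open>m \<ge> 2\<close>; if \<open>m = 1\<close>, doubling \<open>x\<close> changes neither its support nor the constant \<open>A x\<^bsup>0\<^esup>\<close>.\<close>

lemma not_semi_positive_two_solutions:
  assumes "\<not> semi_positive m I A" "m \<ge> 1"
  obtains q x y where "q \<in> vectors I" "\<forall>i\<in>I. q i > 0" "x \<noteq> y"
    "TCP_solution m I q A x" "TCP_solution m I q A y"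
proof -
  obtain x where x: "x \<in> vectors I" "\<forall>i\<in>I. x i \<ge> 0" "x \<noteq> zero_vector I"
    and neg: "\<And>k. k \<in> I \<Longrightarrow> x k > 0 \<Longrightarrow> tensor_apply m I A x k < 0"
    using assms(1) unfolding semi_positive_def by (auto simp: not_le)
  define q where "q = (\<lambda>i\<in>I. if x i > 0 then - tensor_apply m I A x i
                              else \<bar>tensor_apply m I A x i\<bar> + 1)"
  have q: "q \<in> vectors I" "\<forall>i\<in>I. q i > 0"
    using neg by (auto simp: q_def vectors_def)
  have slack: "q i + tensor_apply m I A x i \<ge> 0" if "i \<in> I" for i
    using that by (auto simp: q_def)
  have compl: "x i * (q i + tensor_apply m I A x i) = 0" if "i \<in> I" for i
    using that x(2) by (force simp: q_def)
  have sol: "TCP_solution m I q A x"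
    unfolding TCP_solution_def using x slack compl by (auto intro: sum.neutral)
  show thesis
  proof (cases "m = 1")
    case True
    define y where "y = (\<lambda>i\<in>I. 2 * x i)"
    have same: "tensor_apply m I A y i = tensor_apply m I A x i" if "i \<in> I" for i
      using that True by (simp only: tensor_apply_order_one)
    have "TCP_solution m I q A y"
      unfolding TCP_solution_def
    proof (intro conjI)
      show "(\<Sum>i\<in>I. y i * (q i + tensor_apply m I A y i)) = 0"
      proof (intro sum.neutral ballI)
        fix i assume "i \<in> I"
        then have "y i * (q i + tensor_apply m I A y i) = 2 * (x i * (q i + tensor_apply m I A x i))"
          by (simp only: same) (simp add: y_def)
        then show "y i * (q i + tensor_apply m I A y i) = 0"
          using compl \<open>i \<in> I\<close> by simp
      qed
    qed (use x slack same in \<open>auto simp: y_def vectors_def\<close>)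
    moreover have "x \<noteq> y"
    proof -
      obtain i where "i \<in> I" "x i > 0"
        using x vectors_nonzero_entry by metis
      then have "x i \<noteq> y i"
        by (simp add: y_def)
      then show ?thesis
        by auto
    qed
    ultimately show ?thesis
      using that q sol by blast
  next
    case False
    then have "m \<ge> 2"
      using assms by simp
    then have "TCP_solution m I q A (zero_vector I)"
      unfolding TCP_solution_def using q(2)
      by (simp add: zero_vector_in_vectors tensor_apply_zero_vector)
        (simp add: zero_vector_def less_imp_le)
    then show ?thesis
      using that q sol x(3) by blast
  qed
qed

lemma semi_positive_iff_TCP_unique:
  assumes "finite I" "m \<ge> 1"
  shows "semi_positive m I A \<longleftrightarrow>
    (\<forall>q\<in>vectors I. (\<forall>i\<in>I. q i > 0) \<longrightarrow> (\<exists>!x. TCP_solution m I q A x))"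
proof
  assume "semi_positive m I A"
  then show "\<forall>q\<in>vectors I. (\<forall>i\<in>I. q i > 0) \<longrightarrow> (\<exists>!x. TCP_solution m I q A x)"
    using assms semi_positive_zero_solution semi_positive_solution_is_zero by metis
next
  assume "\<forall>q\<in>vectors I. (\<forall>i\<in>I. q i > 0) \<longrightarrow> (\<exists>!x. TCP_solution m I q A x)"
  then show "semi_positive m I A"
    using assms not_semi_positive_two_solutions[of m I A] by metis
qed

section \<open>Semi-positivity and principal sub-tensors\<close>

text \<open>Extending a vector on \<open>N\<close> by zero changes neither its support nor the values of
  \<open>A x\<^bsup>m-1\<^esup>\<close> on it.\<close>

lemma semi_positive_principal_subtensor:
  assumes "finite I" "N \<subseteq> I" "m \<ge> 1" "semi_positive m I A"
  shows "semi_positive m N (principal_subtensor m N A)"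
  unfolding semi_positive_def
proof (intro ballI impI)
  fix x assume x: "x \<in> vectors N" "(\<forall>i\<in>N. x i \<ge> 0) \<and> x \<noteq> zero_vector N"
  define y where "y = (\<lambda>i\<in>I. if i \<in> N then x i else 0)"
  obtain i where i: "i \<in> N" "x i > 0"
    using x vectors_nonzero_entry by metis
  have "y \<in> vectors I" "\<forall>i\<in>I. y i \<ge> 0"
    using x by (auto simp: y_def vectors_def)
  moreover have "y i \<noteq> zero_vector I i"
    using i \<open>N \<subseteq> I\<close> by (auto simp: y_def zero_vector_def)
  ultimately obtain k where k: "k \<in> I" "y k > 0" "tensor_apply m I A y k \<ge> 0"
    using assms(4) unfolding semi_positive_def by metis
  then have "k \<in> N" "x k > 0"
    by (auto simp: y_def split: if_splits)
  moreover have "tensor_apply m N (principal_subtensor m N A) x k = tensor_apply m I A y k"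
    using assms \<open>k \<in> N\<close> by (intro tensor_apply_principal_subtensor) (auto simp: y_def)
  ultimately show "\<exists>k\<in>N. x k > 0 \<and> tensor_apply m N (principal_subtensor m N A) x k \<ge> 0"
    using k(3) by auto
qed

lemma semi_positive_iff_principal_systems_infeasible:
  assumes "finite I" "m \<ge> 1"
  shows "semi_positive m I A \<longleftrightarrow>
    (\<forall>N. N \<noteq> {} \<and> N \<subseteq> I \<longrightarrow>
       \<not> (\<exists>x\<in>vectors N. (\<forall>i\<in>N. tensor_apply m N (principal_subtensor m N A) x i < 0) \<and>
                        (\<forall>i\<in>N. x i \<ge> 0)))"
    (is "_ \<longleftrightarrow> ?infeasible")
proof
  assume sp: "semi_positive m I A"
  show ?infeasible
  proof (intro allI impI notI, elim conjE bexE)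
    fix N x
    assume N: "N \<noteq> {}" "N \<subseteq> I" and x: "x \<in> vectors N" "\<forall>i\<in>N. x i \<ge> 0"
      and neg: "\<forall>i\<in>N. tensor_apply m N (principal_subtensor m N A) x i < 0"
    have spN: "semi_positive m N (principal_subtensor m N A)"
      using assms N sp by (intro semi_positive_principal_subtensor)
    have "\<exists>k\<in>N. tensor_apply m N (principal_subtensor m N A) x k \<ge> 0"
    proof (cases "x = zero_vector N")
      case True
      then show ?thesis
        using N(1) semi_positive_at_zero[OF spN assms(2)] by auto
    next
      case False
      then show ?thesis
        using spN x unfolding semi_positive_def by blast
    qed
    then show False
      using neg by (auto simp: not_le[symmetric])
  qed
next
  assume inf: ?infeasible
  show "semi_positive m I A"
  proof (rule ccontr)
    assume "\<not> semi_positive m I A"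
    then obtain x where x: "x \<in> vectors I" "\<forall>i\<in>I. x i \<ge> 0" "x \<noteq> zero_vector I"
      and neg: "\<And>k. k \<in> I \<Longrightarrow> x k > 0 \<Longrightarrow> tensor_apply m I A x k < 0"
      unfolding semi_positive_def by (auto simp: not_le)
    define N where "N = {i \<in> I. x i > 0}"
    have N: "N \<noteq> {}" "N \<subseteq> I"
      using x vectors_nonzero_entry[of x I] by (auto simp: N_def)
    have "tensor_apply m N (principal_subtensor m N A) (restrict x N) i = tensor_apply m I A x i"
      if "i \<in> N" for i
    proof (rule tensor_apply_principal_subtensor)
      show "x j = 0" if "j \<in> I - N" for j
        using that x(2) by (force simp: N_def)
    qed (use assms N that in auto)
    then have "\<forall>i\<in>N. tensor_apply m N (principal_subtensor m N A) (restrict x N) i < 0"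
      using neg by (simp add: N_def)
    moreover have "restrict x N \<in> vectors N" "\<forall>i\<in>N. restrict x N i \<ge> 0"
      by (auto simp: vectors_def N_def)
    ultimately show False
      using inf N by blast
  qed
qed

section \<open>The three equivalent conditions\<close>

theorem theorem3p1:
  fixes m n :: nat and A :: "nat list \<Rightarrow> real"
  assumes "m \<ge> 1" and "n \<ge> 1" and "A \<in> tensors m {1..n}"
  shows "(semi_positive m {1..n} A \<longleftrightarrow>
           (\<forall>q\<in>vectors {1..n}. (\<forall>i\<in>{1..n}. q i > 0) \<longrightarrow> (\<exists>!x. TCP_solution m {1..n} q A x)))
       \<and> (semi_positive m {1..n} A \<longleftrightarrow>
           (\<forall>N. N \<noteq> {} \<and> N \<subseteq> {1..n} \<longrightarrow>
              \<not> (\<exists>x\<in>vectors N.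
                    (\<forall>i\<in>N. tensor_apply m N (principal_subtensor m N A) x i < 0) \<and>
                    (\<forall>i\<in>N. x i \<ge> 0))))"
  using semi_positive_iff_TCP_unique[OF finite_atLeastAtMost \<open>m \<ge> 1\<close>]
    semi_positive_iff_principal_systems_infeasible[OF finite_atLeastAtMost \<open>m \<ge> 1\<close>]
  by (rule conjI)

end
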